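(* Let $E$ be a $\sigma$-Dedekind complete Banach lattice. The following statements are equivalent. (1) $E$ is finite dimensional. (2) Every positive disjointly weakly compact operator $T:E\to E$ is $M$-weakly compact.
   Context: Banach lattices are real; $B_X$ is the closed unit ball of $X$. A Banach lattice is $\sigma$-Dedekind complete if every countable nonempty subset that is bounded above has a supremum. A sequence $(x_n)$ in a Banach lattice is disjoint if $|x_n|\wedge|x_m|=0$ for $n\neq m$. $Sol(A)=\{x: |x|\le |a| \text{ for some } a\in A\}$ is the solid hull of $A$. A norm bounded set $A$ in a Banach lattice is disjointly weakly compact if every disjoint sequence in $Sol(A)$ converges weakly to zero. A bounded linear operator $T$ from a Banach space $X$ to a Banach lattice is disjointly weakly compact if $T(B_X)$ is a disjointly weakly compact set. A continuous linear operator $T:E\to X$ from a Banach lattice to a Banach space is $M$-weakly compact if $\lim\|Tx_n\|=0$ for every norm bounded disjoint sequence $(x_n)\subset E$. *)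

theory Defs
  imports "HOL-Analysis.Analysis" "HOL-Library.Lattice_Algebras" "HOL-Library.Lub_Glb"
begin

class banach_lattice = banach + ordered_real_vector + lattice_ab_group_add_abs +
  assumes norm_mono_abs: "\<bar>x\<bar> \<le> \<bar>y\<bar> \<Longrightarrow> norm x \<le> norm y"

definition sigma_dedekind_complete :: "'a::banach_lattice itself \<Rightarrow> bool" where
  "sigma_dedekind_complete _ \<longleftrightarrow>
     (\<forall>A :: 'a set. countable A \<and> A \<noteq> {} \<and> bdd_above A \<longrightarrow> (\<exists>s. isLub UNIV A s))"

definition finite_dimensional :: "'a::real_vector itself \<Rightarrow> bool" where
  "finite_dimensional _ \<longleftrightarrow> (\<exists>B :: 'a set. finite B \<and> span B = UNIV)"

definition disjoint_seq :: "(nat \<Rightarrow> 'a::banach_lattice) \<Rightarrow> bool" where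
  "disjoint_seq x \<longleftrightarrow> (\<forall>n m. n \<noteq> m \<longrightarrow> inf \<bar>x n\<bar> \<bar>x m\<bar> = 0)"

definition solid_hull :: "'a::banach_lattice set \<Rightarrow> 'a set" where
  "solid_hull A = {x. \<exists>a\<in>A. \<bar>x\<bar> \<le> \<bar>a\<bar>}"

definition weakly_tendsto :: "(nat \<Rightarrow> 'a::real_normed_vector) \<Rightarrow> 'a \<Rightarrow> bool" where
  "weakly_tendsto x l \<longleftrightarrow>
     (\<forall>f :: 'a \<Rightarrow> real. bounded_linear f \<longrightarrow> (\<lambda>n. f (x n)) \<longlonglongrightarrow> f l)"

definition disjointly_weakly_compact_set :: "'a::banach_lattice set \<Rightarrow> bool" where
  "disjointly_weakly_compact_set A \<longleftrightarrow> bounded A \<and>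
     (\<forall>x. disjoint_seq x \<and> range x \<subseteq> solid_hull A \<longrightarrow> weakly_tendsto x 0)"

definition disjointly_weakly_compact_operator ::
    "('x::banach \<Rightarrow> 'a::banach_lattice) \<Rightarrow> bool" where
  "disjointly_weakly_compact_operator T \<longleftrightarrow>
     bounded_linear T \<and> disjointly_weakly_compact_set (T ` cball 0 1)"

definition M_weakly_compact_operator :: "('a::banach_lattice \<Rightarrow> 'x::banach) \<Rightarrow> bool" where
  "M_weakly_compact_operator T \<longleftrightarrow> bounded_linear T \<and>
     (\<forall>x. bounded (range x) \<and> disjoint_seq x \<longrightarrow> (\<lambda>n. norm (T (x n))) \<longlonglongrightarrow> 0)"

definition positive_operator :: "('a::banach_lattice \<Rightarrow> 'b::banach_lattice) \<Rightarrow> bool" where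
  "positive_operator T \<longleftrightarrow> linear T \<and> (\<forall>x. 0 \<le> x \<longrightarrow> 0 \<le> T x)"

end

(* Order bounded disjoint sequences are weakly null, so every rank one operator x |-> g(x) e is
   disjointly weakly compact. If these are M-weakly compact for g = |f|, then |f|(|x_n|) -> 0 for
   every bounded disjoint sequence (x_n) and every bounded functional f. Hence the identity is
   disjointly weakly compact, hence M-weakly compact, so bounded disjoint sequences are norm null;
   this excludes normalised disjoint sequences, which exist in every infinite-dimensional Banach
   lattice. In finite dimension a disjoint sequence has only finitely many nonzero terms because
   these are linearly independent. *)
theory Submission
  imports Defs
begin

section \<open>Order structure of a Banach lattice\<close>

lemma abs_le_iff_interval:
  fixes x y :: "'a::banach_lattice"
  shows "\<bar>x\<bar> \<le> y \<longleftrightarrow> x \<le> y \<and> - y \<le> x"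
  by (auto simp: abs_lattice minus_le_iff)

lemma norm_abs_eq [simp]:
  fixes x :: "'a::banach_lattice"
  shows "norm \<bar>x\<bar> = norm x"
  by (intro antisym norm_mono_abs) auto

lemma norm_mono_nonneg:
  fixes x y :: "'a::banach_lattice"
  assumes "0 \<le> x" "x \<le> y"
  shows "norm x \<le> norm y"
  using assms by (intro norm_mono_abs) (auto intro: order_trans)

text \<open>The sign of \<open>c\<close> decides which monotone scaling gives \<open>\<le>\<close>.
  The converse applies that inequality to the scalar \<open>inverse c\<close> and the vector
  \<open>c *\<^sub>R x\<close>.\<close>

lemma abs_scaleR_lattice:
  fixes x :: "'a::banach_lattice"
  shows "\<bar>c *\<^sub>R x\<bar> = \<bar>c\<bar> *\<^sub>R \<bar>x\<bar>"
proof -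
  have le: "\<bar>c *\<^sub>R x\<bar> \<le> \<bar>c\<bar> *\<^sub>R \<bar>x\<bar>" for c and x :: 'a
  proof (cases "0 \<le> c")
    case True
    then have "c *\<^sub>R x \<le> c *\<^sub>R \<bar>x\<bar>" "c *\<^sub>R (- x) \<le> c *\<^sub>R \<bar>x\<bar>"
      by (intro scaleR_left_mono; simp add: abs_ge_self abs_ge_minus_self)+
    with True show ?thesis by (simp add: abs_le_iff_interval minus_le_iff)
  next
    case False
    then have "(- c) *\<^sub>R x \<le> (- c) *\<^sub>R \<bar>x\<bar>" "(- c) *\<^sub>R (- x) \<le> (- c) *\<^sub>R \<bar>x\<bar>"
      by (intro scaleR_left_mono; simp add: abs_ge_self abs_ge_minus_self)+
    with False show ?thesis by (simp add: abs_le_iff_interval minus_le_iff)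
  qed
  show ?thesis
  proof (cases "c = 0")
    case False
    have "\<bar>c\<bar> *\<^sub>R \<bar>inverse c *\<^sub>R (c *\<^sub>R x)\<bar> \<le> \<bar>c\<bar> *\<^sub>R (\<bar>inverse c\<bar> *\<^sub>R \<bar>c *\<^sub>R x\<bar>)"
      by (intro scaleR_left_mono le) simp
    with False have "\<bar>c\<bar> *\<^sub>R \<bar>x\<bar> \<le> \<bar>c *\<^sub>R x\<bar>" by simp
    with le show ?thesis by (intro antisym)
  qed simp
qed

text \<open>By monotonicity of the norm, the positive part of \<open>x - y\<close> has norm at most
  \<open>e * norm a\<close> for every positive \<open>e\<close>, so it vanishes.\<close>

lemma archimedean_le:
  fixes x y a :: "'a::banach_lattice"
  assumes "0 \<le> a" and le: "\<And>e. 0 < e \<Longrightarrow> x \<le> y + e *\<^sub>R a"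
  shows "x \<le> y"
proof -
  let ?p = "pprt (x - y)"
  have bound: "norm ?p \<le> e * norm a" if "0 < e" for e :: real
  proof -
    have "?p \<le> e *\<^sub>R a"
      unfolding pprt_def using le[OF that] that assms(1)
      by (auto simp: algebra_simps intro: scaleR_nonneg_nonneg)
    then have "norm ?p \<le> norm (e *\<^sub>R a)" by (intro norm_mono_nonneg) auto
    with that show ?thesis by simp
  qed
  have "norm ?p \<le> 0 + e" if "0 < e" for e :: real
  proof -
    \<comment> \<open>The \<open>+ 1\<close> keeps the denominator positive when
      \<open>a = 0\<close>.\<close>
    have "norm ?p \<le> e / (norm a + 1) * norm a"
      using that by (intro bound) (simp add: add_nonneg_pos)
    also have "\<dots> \<le> e"
      using that by (simp add: pos_divide_le_eq add_nonneg_pos distrib_left)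
    finally show ?thesis by simp
  qed
  then have "norm ?p \<le> 0" by (rule field_le_epsilon)
  then have "x - y \<le> 0" by (simp add: le_zero_iff_zero_pprt)
  then show ?thesis by simp
qed

text \<open>Truncating \<open>y\<close> to the interval from \<open>- a\<close> to \<open>a\<close>
  gives \<open>u\<close>; the remainder \<open>y - u\<close> then stays within
  \<open>b\<close>.\<close>

lemma riesz_decomposition:
  fixes y :: "'a::banach_lattice"
  assumes "0 \<le> a" "0 \<le> b" "\<bar>y\<bar> \<le> a + b"
  obtains u v where "y = u + v" "\<bar>u\<bar> \<le> a" "\<bar>v\<bar> \<le> b"
proof
  define u where "u = inf (sup y (- a)) a"
  have y: "y \<le> a + b" "- (a + b) \<le> y" using assms(3) by (auto simp: abs_le_iff_interval)
  show "y = u + (y - u)" by simp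
  have "- a \<le> a" using assms(1) by (rule order_trans[rotated]) (use assms(1) in simp)
  then show "\<bar>u\<bar> \<le> a" unfolding u_def by (auto simp: abs_le_iff_interval)
  have "y - b \<le> y" using assms by simp
  then have "y - b \<le> u" using y unfolding u_def by (intro le_infI le_supI1) (auto simp: diff_le_eq)
  moreover have "sup y (- a) \<le> y + b"
    using assms y by (auto simp: algebra_simps minus_le_iff)
  then have "u \<le> y + b" unfolding u_def by (rule le_infI1)
  ultimately show "\<bar>y - u\<bar> \<le> b" by (auto simp: abs_le_iff_interval algebra_simps)
qed

section \<open>Disjointness\<close>

lemma nonneg_if_inf_eq_0:
  fixes a b :: "'a::banach_lattice"
  assumes "inf a b = 0"
  shows "0 \<le> a" "0 \<le> b"
  unfolding assms[symmetric] by simp_all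

text \<open>Let \<open>w = inf (a + b) c\<close>. Then \<open>w - b\<close> is below both
  \<open>a\<close> and \<open>c\<close>, hence \<open>w \<le> b\<close>. Since also
  \<open>w \<le> c\<close>, disjointness of \<open>b\<close> and \<open>c\<close> gives
  \<open>w \<le> 0\<close>.\<close>

lemma inf_add_eq_0:
  fixes a b c :: "'a::banach_lattice"
  assumes "inf a c = 0" "inf b c = 0"
  shows "inf (a + b) c = 0"
proof (rule antisym)
  have nonneg: "0 \<le> a" "0 \<le> b" "0 \<le> c"
    using nonneg_if_inf_eq_0[OF assms(1)] nonneg_if_inf_eq_0[OF assms(2)] by auto
  let ?w = "inf (a + b) c"
  have "?w - b \<le> a" by (simp add: diff_le_eq)
  moreover have "?w - b \<le> c" using nonneg by (simp add: diff_le_eq le_infI2 add_increasing2)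
  ultimately have "?w - b \<le> inf a c" by simp
  with assms have "?w \<le> b" by simp
  then have "?w \<le> inf b c" by simp
  with assms show "?w \<le> 0" by simp
  show "0 \<le> ?w" using nonneg by simp
qed

lemma pprt_diff_pprt_uminus:
  fixes x :: "'a::banach_lattice"
  shows "pprt x - pprt (- x) = x"
  using prts[of x] by (simp add: pprt_neg)

text \<open>Translation by \<open>- pprt (- x)\<close> turns the infimum into
  \<open>inf x 0\<close>, which is \<open>- pprt (- x)\<close> itself.\<close>

lemma inf_pprt_uminus:
  fixes x :: "'a::banach_lattice"
  shows "inf (pprt x) (pprt (- x)) = 0"
proof -
  have "inf (pprt x) (pprt (- x)) + - pprt (- x) = inf (pprt x + - pprt (- x)) (pprt (- x) + - pprt (- x))"
    by (rule add_inf_distrib_right)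
  also have "\<dots> = inf x 0" by (simp add: pprt_diff_pprt_uminus)
  also have "\<dots> = - pprt (- x)" by (simp add: pprt_neg nprt_def)
  finally show ?thesis by simp
qed

lemma inf_sum_eq_0:
  fixes x :: "'i \<Rightarrow> 'a::banach_lattice"
  assumes "0 \<le> c" "\<And>i. i \<in> I \<Longrightarrow> inf (x i) c = 0"
  shows "inf (\<Sum>i\<in>I. x i) c = 0"
  using assms
proof (induction I rule: infinite_finite_induct)
  case (insert i I)
  then show ?case by (simp add: inf_add_eq_0)
qed (auto simp: inf_absorb1)

lemma inf_eq_0_mono:
  fixes a b c d :: "'a::banach_lattice"
  assumes "inf a b = 0" "0 \<le> c" "c \<le> a" "0 \<le> d" "d \<le> b"
  shows "inf c d = 0"
  using assms by (metis antisym inf_mono le_inf_iff)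

lemma inf_scaleR_eq_0:
  fixes a b :: "'a::banach_lattice"
  assumes "inf a b = 0" "0 \<le> s" "0 \<le> t"
  shows "inf (s *\<^sub>R a) (t *\<^sub>R b) = 0"
proof (rule antisym)
  note nonneg = nonneg_if_inf_eq_0[OF assms(1)]
  \<comment> \<open>A common upper bound of \<open>s\<close> and \<open>t\<close> that is positive
    even if both vanish, so that it can be divided out.\<close>
  define k where "k = s + t + 1"
  have k: "0 < k" "s \<le> k" "t \<le> k" using assms by (auto simp: k_def)
  let ?w = "inf (s *\<^sub>R a) (t *\<^sub>R b)"
  have "?w \<le> k *\<^sub>R a" "?w \<le> k *\<^sub>R b"
    using nonneg k by (auto intro: le_infI1 le_infI2 scaleR_right_mono)
  then have "inverse k *\<^sub>R ?w \<le> inverse k *\<^sub>R (k *\<^sub>R a)" "inverse k *\<^sub>R ?w \<le> inverse k *\<^sub>R (k *\<^sub>R b)"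
    using k by (intro scaleR_left_mono; simp)+
  with k have "inverse k *\<^sub>R ?w \<le> inf a b" by simp
  then have "k *\<^sub>R (inverse k *\<^sub>R ?w) \<le> k *\<^sub>R 0"
    using k assms(1) by (intro scaleR_left_mono) auto
  with k show "?w \<le> 0" by simp
  show "0 \<le> ?w" using nonneg assms by (auto intro: scaleR_nonneg_nonneg)
qed

text \<open>Disjointness turns the sum into a supremum: \<open>a + b = sup a b\<close> whenever
  \<open>inf a b = 0\<close>.\<close>

lemma sum_disjoint_le:
  fixes x :: "'i \<Rightarrow> 'a::banach_lattice"
  assumes "0 \<le> e" "\<And>i. i \<in> I \<Longrightarrow> 0 \<le> x i" "\<And>i. i \<in> I \<Longrightarrow> x i \<le> e"
    and "\<And>i j. i \<in> I \<Longrightarrow> j \<in> I \<Longrightarrow> i \<noteq> j \<Longrightarrow> inf (x i) (x j) = 0"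
  shows "(\<Sum>i\<in>I. x i) \<le> e"
  using assms
proof (induction I rule: infinite_finite_induct)
  case (insert i I)
  have "inf (\<Sum>j\<in>I. x j) (x i) = 0"
    using insert by (intro inf_sum_eq_0) auto
  then have "x i + (\<Sum>j\<in>I. x j) = sup (x i) (\<Sum>j\<in>I. x j)"
    using add_eq_inf_sup[of "x i" "\<Sum>j\<in>I. x j"] by (simp add: inf_commute)
  also have "\<dots> \<le> e" using insert by auto
  finally show ?case using insert by simp
qed auto

section \<open>Linear independence of disjoint elements\<close>

lemma abs_sum_le_lattice:
  fixes x :: "'i \<Rightarrow> 'a::banach_lattice"
  shows "\<bar>\<Sum>i\<in>I. x i\<bar> \<le> (\<Sum>i\<in>I. \<bar>x i\<bar>)"
proof (induction I rule: infinite_finite_induct)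
  case (insert i I)
  then show ?case
    by (simp add: order_trans[OF abs_triangle_ineq] add_mono)
qed auto

text \<open>In a vanishing linear combination each term is, up to sign, the sum of the others. Its
  modulus is therefore below a sum of elements disjoint from it, so it equals its infimum with that
  sum, which is 0.\<close>

lemma independent_if_disjoint:
  fixes S :: "'a::banach_lattice set"
  assumes "0 \<notin> S" and disj: "\<And>x y. x \<in> S \<Longrightarrow> y \<in> S \<Longrightarrow> x \<noteq> y \<Longrightarrow> inf \<bar>x\<bar> \<bar>y\<bar> = 0"
  shows "independent S"
  unfolding independent_explicit_module
proof (intro allI impI)
  fix F u v
  assume F: "finite F" "F \<subseteq> S" and sum0: "(\<Sum>v\<in>F. u v *\<^sub>R v) = 0" and v: "v \<in> F"
  let ?r = "\<Sum>w\<in>F - {v}. \<bar>u w *\<^sub>R w\<bar>"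
  have "u v *\<^sub>R v = - (\<Sum>w\<in>F - {v}. u w *\<^sub>R w)"
    using sum0 F v by (simp add: sum.remove eq_neg_iff_add_eq_0)
  then have le: "\<bar>u v *\<^sub>R v\<bar> \<le> ?r"
    by (simp only: abs_minus_cancel abs_sum_le_lattice)
  have "inf ?r \<bar>u v *\<^sub>R v\<bar> = 0"
  proof (intro inf_sum_eq_0)
    fix w assume "w \<in> F - {v}"
    with F v have "inf \<bar>w\<bar> \<bar>v\<bar> = 0" by (intro disj) auto
    then show "inf \<bar>u w *\<^sub>R w\<bar> \<bar>u v *\<^sub>R v\<bar> = 0"
      by (simp add: abs_scaleR_lattice inf_scaleR_eq_0)
  qed simp
  with le have "u v *\<^sub>R v = 0" by (simp add: inf_absorb2)
  moreover have "v \<noteq> 0" using assms(1) F v by auto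
  ultimately show "u v = 0" by simp
qed

lemma finite_nonzero_disjoint_seq:
  fixes x :: "nat \<Rightarrow> 'a::banach_lattice"
  assumes "finite_dimensional TYPE('a)" "disjoint_seq x"
  shows "finite {n. x n \<noteq> 0}"
proof -
  let ?N = "{n. x n \<noteq> 0}"
  obtain B :: "'a set" where B: "finite B" "span B = UNIV"
    using assms(1) by (auto simp: finite_dimensional_def)
  have disj: "inf \<bar>x n\<bar> \<bar>x m\<bar> = 0" if "n \<noteq> m" for n m
    using assms(2) that by (auto simp: disjoint_seq_def)
  have inj: "inj_on x ?N"
  proof (rule inj_onI)
    fix n m assume "n \<in> ?N" "x n = x m"
    \<comment> \<open>For different indices the common nonzero value would be disjoint from
      itself.\<close>
    with disj[of n m] show "n = m" by auto
  qed
  have "independent (x ` ?N)"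
    by (rule independent_if_disjoint) (use disj in \<open>auto, metis\<close>)
  then have "finite (x ` ?N)" using B independent_span_bound by blast
  with inj show ?thesis by (rule finite_imageD[rotated])
qed

section \<open>Disjoint sequences in infinite dimension\<close>

text \<open>Atoms are encoded by indecomposability, not by the interval below \<open>a\<close>
  consisting of multiples of \<open>a\<close>: its failure directly supplies a disjoint pair to
  split into. The condition \<open>inf u v = 0\<close> already makes \<open>u\<close> and
  \<open>v\<close> nonnegative.\<close>

definition lattice_atom :: "'a::banach_lattice \<Rightarrow> bool" where
  "lattice_atom a \<longleftrightarrow> 0 \<le> a \<and> a \<noteq> 0 \<and>
     (\<forall>u v. u \<le> a \<and> v \<le> a \<and> inf u v = 0 \<longrightarrow> u = 0 \<or> v = 0)"

text \<open>The positive and negative parts of \<^term>\<open>x - s *\<^sub>R a\<close>, scaled down into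
  the interval below \<^term>\<open>a\<close>, are disjoint, so one of them vanishes.\<close>

lemma lattice_atom_comparable:
  fixes a x :: "'a::banach_lattice"
  assumes a: "lattice_atom a" and x: "0 \<le> x" "x \<le> a" and "0 \<le> s"
  shows "x \<le> s *\<^sub>R a \<or> s *\<^sub>R a \<le> x"
proof -
  let ?d = "x - s *\<^sub>R a"
  \<comment> \<open>The two parts of \<open>?d\<close> are bounded by \<open>a\<close> and by
    \<open>s *\<^sub>R a\<close>; this factor brings both below \<open>a\<close>.\<close>
  define k where "k = inverse (s + 1)"
  have k: "0 < k" "k \<le> 1" "k * s \<le> 1" using \<open>0 \<le> s\<close> by (auto simp: k_def field_simps)
  have a0: "0 \<le> a" using a by (simp add: lattice_atom_def)
  have disj: "inf (k *\<^sub>R pprt ?d) (k *\<^sub>R pprt (- ?d)) = 0"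
    using k by (intro inf_scaleR_eq_0 inf_pprt_uminus) auto
  have "pprt ?d \<le> a"
    unfolding pprt_def using x a0 \<open>0 \<le> s\<close>
    by (auto simp: diff_le_eq intro!: add_increasing2 scaleR_nonneg_nonneg)
  then have "k *\<^sub>R pprt ?d \<le> k *\<^sub>R a" using k by (intro scaleR_left_mono) auto
  also have "\<dots> \<le> 1 *\<^sub>R a" using k a0 by (intro scaleR_right_mono) auto
  finally have 1: "k *\<^sub>R pprt ?d \<le> a" by simp
  have "pprt (- ?d) \<le> s *\<^sub>R a"
    unfolding pprt_def using x a0 \<open>0 \<le> s\<close>
    by (auto intro: scaleR_nonneg_nonneg)
  then have "k *\<^sub>R pprt (- ?d) \<le> k *\<^sub>R (s *\<^sub>R a)" using k by (intro scaleR_left_mono) auto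
  also have "\<dots> \<le> 1 *\<^sub>R a" using k a0 unfolding scaleR_scaleR by (intro scaleR_right_mono) auto
  finally have 2: "k *\<^sub>R pprt (- ?d) \<le> a" by simp
  have "k *\<^sub>R pprt ?d = 0 \<or> k *\<^sub>R pprt (- ?d) = 0"
    using a 1 2 disj unfolding lattice_atom_def by blast
  with k have "x - s *\<^sub>R a \<le> 0 \<or> s *\<^sub>R a - x \<le> 0" by (simp add: le_zero_iff_zero_pprt)
  then show ?thesis by simp
qed

text \<open>The admissible scales are bounded because the norm is monotone, and their supremum is
  attained by the Archimedean property.\<close>

lemma greatest_scale_below:
  fixes a x :: "'a::banach_lattice"
  assumes "0 \<le> a" "a \<noteq> 0" "0 \<le> x"
  obtains t where "0 \<le> t" "t *\<^sub>R a \<le> x" "\<And>s. s *\<^sub>R a \<le> x \<Longrightarrow> s \<le> t"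
proof
  \<comment> \<open>On nonnegative scales the norm comparison applies; negative scales lie below the
    supremum because 0 is admissible.\<close>
  let ?S = "{s. 0 \<le> s \<and> s *\<^sub>R a \<le> x}"
  have bound: "s \<le> norm x / norm a" if "s \<in> ?S" for s
  proof -
    have "norm (s *\<^sub>R a) \<le> norm x"
      using that assms by (intro norm_mono_nonneg) (auto intro: scaleR_nonneg_nonneg)
    with that assms show ?thesis by (simp add: field_simps)
  qed
  then have bdd: "bdd_above ?S" by (rule bdd_aboveI)
  have 0: "0 \<in> ?S" using assms by simp
  show "0 \<le> Sup ?S" using 0 bdd by (rule cSup_upper)
  show "s \<le> Sup ?S" if "s *\<^sub>R a \<le> x" for s
  proof (cases "0 \<le> s")
    case True
    with that bdd show ?thesis by (intro cSup_upper) auto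
  next
    case False
    with \<open>0 \<le> Sup ?S\<close> show ?thesis by linarith
  qed
  show "Sup ?S *\<^sub>R a \<le> x"
  proof (rule archimedean_le[OF assms(1)])
    fix e :: real assume "0 < e"
    then have "\<exists>s\<in>?S. Sup ?S - e < s" using 0 bdd by (subst less_cSup_iff[symmetric]) auto
    then obtain s where s: "s \<in> ?S" "Sup ?S \<le> s + e" by force
    then have "Sup ?S *\<^sub>R a \<le> (s + e) *\<^sub>R a" using assms by (intro scaleR_right_mono) auto
    also have "\<dots> \<le> x + e *\<^sub>R a" using s by (simp add: scaleR_left_distrib)
    finally show "Sup ?S *\<^sub>R a \<le> x + e *\<^sub>R a" .
  qed
qed

text \<open>For the greatest \<open>t\<close> with \<open>t *\<^sub>R a \<le> x\<close>, no larger
  scale \<open>t + e\<close> is admissible, so comparability gives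
  \<open>x \<le> (t + e) *\<^sub>R a\<close>. Letting \<open>e\<close> tend to 0 yields
  equality.\<close>

lemma lattice_atom_below_multiple:
  fixes a x :: "'a::banach_lattice"
  assumes a: "lattice_atom a" and x: "0 \<le> x" "x \<le> a"
  obtains t where "0 \<le> t" "x = t *\<^sub>R a"
proof -
  have a0: "0 \<le> a" "a \<noteq> 0" using a by (auto simp: lattice_atom_def)
  obtain t where t: "0 \<le> t" "t *\<^sub>R a \<le> x" "\<And>s. s *\<^sub>R a \<le> x \<Longrightarrow> s \<le> t"
    using greatest_scale_below[OF a0 x(1)] by blast
  have "x \<le> t *\<^sub>R a"
  proof (rule archimedean_le[OF a0(1)])
    fix e :: real assume "0 < e"
    with t(3)[of "t + e"] have "\<not> (t + e) *\<^sub>R a \<le> x" by auto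
    with lattice_atom_comparable[OF a x, of "t + e"] t(1) \<open>0 < e\<close>
    show "x \<le> t *\<^sub>R a + e *\<^sub>R a" by (simp add: scaleR_left_distrib)
  qed
  with t that show thesis by (meson antisym)
qed

text \<open>Splitting an element without atoms below it again and again yields a disjoint sequence.\<close>

lemma ex_lattice_atom_below:
  fixes x :: "'a::banach_lattice"
  assumes no_seq: "\<And>y :: nat \<Rightarrow> 'a. disjoint_seq y \<Longrightarrow> \<exists>n. y n = 0"
    and x: "0 \<le> x" "x \<noteq> 0"
  obtains a where "lattice_atom a" "a \<le> x"
proof (rule ccontr)
  assume "\<not> thesis"
  with that have no_atom: "\<And>a. a \<le> x \<Longrightarrow> \<not> lattice_atom a" by blast
  \<comment> \<open>The first component becomes a term of the sequence; the second is kept to be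
    split at the next stage.\<close>
  define P where "P = (\<lambda>w :: 'a \<times> 'a. fst w \<noteq> 0 \<and> snd w \<noteq> 0 \<and> inf (fst w) (snd w) = 0
    \<and> fst w \<le> x \<and> snd w \<le> x)"
  have split: "\<exists>w. P w \<and> fst w \<le> y \<and> snd w \<le> y" if "0 \<le> y" "y \<noteq> 0" "y \<le> x" for y
  proof -
    have "\<exists>u v. u \<le> y \<and> v \<le> y \<and> inf u v = 0 \<and> u \<noteq> 0 \<and> v \<noteq> 0"
      using no_atom[OF \<open>y \<le> x\<close>] \<open>0 \<le> y\<close> \<open>y \<noteq> 0\<close> unfolding lattice_atom_def by blast
    then obtain u v where "u \<le> y" "v \<le> y" "inf u v = 0" "u \<noteq> 0" "v \<noteq> 0" by blast
    then have "P (u, v)" using \<open>y \<le> x\<close> unfolding P_def by (auto intro: order_trans)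
    with \<open>u \<le> y\<close> \<open>v \<le> y\<close> show ?thesis by (intro exI[of _ "(u, v)"]) simp
  qed
  have P: "fst w \<noteq> 0" "snd w \<noteq> 0" "0 \<le> fst w" "0 \<le> snd w" "fst w \<le> x" "snd w \<le> x"
    "inf (fst w) (snd w) = 0" if "P w" for w
    using that nonneg_if_inf_eq_0[of "fst w" "snd w"] unfolding P_def by blast+
  have "\<exists>f. \<forall>n. P (f n) \<and> fst (f (Suc n)) \<le> snd (f n) \<and> snd (f (Suc n)) \<le> snd (f n)"
  proof (rule dependent_nat_choice)
    show "\<exists>w. P w" using split[OF x order_refl] by blast
    fix w and n :: nat assume "P w"
    then show "\<exists>w'. P w' \<and> fst w' \<le> snd w \<and> snd w' \<le> snd w"
      by (intro split P)
  qed
  then obtain f where f: "\<And>n. P (f n)" "\<And>n. fst (f (Suc n)) \<le> snd (f n)"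
    "\<And>n. snd (f (Suc n)) \<le> snd (f n)" by blast
  \<comment> \<open>The second components decrease, so every later first component lies below
    \<open>snd (f n)\<close>, which is disjoint from \<open>fst (f n)\<close>.\<close>
  have below: "fst (f m) \<le> snd (f n)" if "n < m" for n m
  proof -
    have "snd (f (m - 1)) \<le> snd (f n)"
      by (rule lift_Suc_antimono_le[of "\<lambda>n. snd (f n)", OF f(3)]) (use that in simp)
    moreover have "fst (f m) \<le> snd (f (m - 1))" using f(2)[of "m - 1"] that by simp
    ultimately show ?thesis by (rule order_trans[rotated])
  qed
  have disj: "inf (fst (f n)) (fst (f m)) = 0" if "n < m" for n m
    by (rule inf_eq_0_mono[OF P(7)[OF f(1)] _ _ _ below[OF that]]) (auto intro: P f)
  have "disjoint_seq (\<lambda>n. fst (f n))"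
    unfolding disjoint_seq_def
  proof (intro allI impI)
    fix n m :: nat assume "n \<noteq> m"
    then have "inf (fst (f n)) (fst (f m)) = 0"
      using disj[of n m] disj[of m n] by (metis inf_commute linorder_neq_iff)
    then show "inf \<bar>fst (f n)\<bar> \<bar>fst (f m)\<bar> = 0" by (simp add: P(3)[OF f(1)])
  qed
  from no_seq[OF this] P(1)[OF f(1)] show False by blast
qed

text \<open>For each atom \<open>a\<close> the greatest multiple \<open>t a *\<^sub>R a\<close>
  below \<open>x\<close> is subtracted; by disjointness the sum of these multiples is still below
  \<open>x\<close>. The remainder is nonzero because \<open>x\<close> is outside the span. It meets
  \<open>a\<close> in some \<open>s *\<^sub>R a\<close>, and maximality of \<open>t a\<close> forces
  \<open>s = 0\<close>.\<close>

lemma disjoint_from_finite_atoms: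
  fixes M :: "'a::banach_lattice set"
  assumes M: "finite M" "\<And>a. a \<in> M \<Longrightarrow> lattice_atom a"
    and disj: "\<And>a b. a \<in> M \<Longrightarrow> b \<in> M \<Longrightarrow> a \<noteq> b \<Longrightarrow> inf a b = 0"
    and x: "0 \<le> x" "x \<notin> span M"
  obtains y where "0 \<le> y" "y \<noteq> 0" "\<And>a. a \<in> M \<Longrightarrow> inf y a = 0"
proof -
  have pos: "0 \<le> a" "a \<noteq> 0" if "a \<in> M" for a using M(2)[OF that] by (auto simp: lattice_atom_def)
  have "\<exists>t. 0 \<le> t \<and> t *\<^sub>R a \<le> x \<and> (\<forall>s. s *\<^sub>R a \<le> x \<longrightarrow> s \<le> t)" if "a \<in> M" for a
    by (rule greatest_scale_below[OF pos[OF that] x(1)]) blast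
  then obtain t where t: "\<And>a. a \<in> M \<Longrightarrow> 0 \<le> t a" "\<And>a. a \<in> M \<Longrightarrow> t a *\<^sub>R a \<le> x"
    "\<And>a s. a \<in> M \<Longrightarrow> s *\<^sub>R a \<le> x \<Longrightarrow> s \<le> t a"
    by metis
  let ?p = "\<Sum>a\<in>M. t a *\<^sub>R a"
  have tpos: "0 \<le> t a *\<^sub>R a" if "a \<in> M" for a using t pos that by (intro scaleR_nonneg_nonneg)
  have px: "?p \<le> x"
    using x t tpos disj by (intro sum_disjoint_le) (auto intro: inf_scaleR_eq_0)
  show thesis
  proof
    show "0 \<le> x - ?p" using px by simp
    have "?p \<in> span M" by (intro span_sum span_scale span_base)
    with x show "x - ?p \<noteq> 0" by auto
    fix a assume a: "a \<in> M"
    let ?w = "inf (x - ?p) a"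
    obtain s where s: "0 \<le> s" "?w = s *\<^sub>R a"
      using lattice_atom_below_multiple[OF M(2)[OF a], of ?w] px pos a by auto
    have "t a *\<^sub>R a \<le> ?p" using a M(1) tpos sum_mono2[of M "{a}" "\<lambda>a. t a *\<^sub>R a"] by auto
    moreover have "s *\<^sub>R a \<le> x - ?p" unfolding s(2)[symmetric] by simp
    ultimately have "s *\<^sub>R a + t a *\<^sub>R a \<le> (x - ?p) + ?p" by (intro add_mono)
    then have "(s + t a) *\<^sub>R a \<le> x" by (simp add: scaleR_left_distrib)
    from t(3)[OF a this] s show "?w = 0" by simp
  qed
qed

text \<open>Otherwise a maximal disjoint family of atoms, given by Zorn's lemma, is finite. It spans
  the space: a positive vector outside its span would yield a nonzero positive element disjoint from
  the family, and an atom below that element would enlarge the family.\<close>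

lemma ex_disjoint_seq_nonzero:
  assumes inf: "\<not> finite_dimensional TYPE('a::banach_lattice)"
  obtains x :: "nat \<Rightarrow> 'a::banach_lattice" where "disjoint_seq x" "\<And>n. x n \<noteq> 0"
proof (rule ccontr)
  assume "\<not> thesis"
  with that have no_seq: "\<And>y :: nat \<Rightarrow> 'a. disjoint_seq y \<Longrightarrow> \<exists>n. y n = 0" by blast
  define D where "D = {A :: 'a set. (\<forall>a\<in>A. lattice_atom a) \<and> (\<forall>a\<in>A. \<forall>b\<in>A. a \<noteq> b \<longrightarrow> inf a b = 0)}"
  have "\<exists>M\<in>D. \<forall>X\<in>D. M \<subseteq> X \<longrightarrow> X = M"
  proof (rule subset_Zorn)
    fix C assume C: "subset.chain D C"
    have "\<Union>C \<in> D"
      unfolding D_def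
    proof (clarsimp, intro conjI ballI impI)
      show "lattice_atom a" if "X \<in> C" "a \<in> X" for X a
        using that C by (auto simp: D_def subset_chain_def)
      fix X a Y b assume "X \<in> C" "a \<in> X" "Y \<in> C" "b \<in> Y" "a \<noteq> b"
      moreover have "X \<subseteq> Y \<or> Y \<subseteq> X" using C \<open>X \<in> C\<close> \<open>Y \<in> C\<close> by (auto simp: subset_chain_def)
      ultimately show "inf a b = 0" using C unfolding D_def subset_chain_def by blast
    qed
    then show "\<exists>U\<in>D. \<forall>X\<in>C. X \<subseteq> U" by blast
  qed
  then obtain M where M: "M \<in> D" and max: "\<And>X. X \<in> D \<Longrightarrow> M \<subseteq> X \<Longrightarrow> X = M" by blast
  have atom: "\<And>a. a \<in> M \<Longrightarrow> lattice_atom a"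
    and disj: "\<And>a b. a \<in> M \<Longrightarrow> b \<in> M \<Longrightarrow> a \<noteq> b \<Longrightarrow> inf a b = 0"
    using M by (auto simp: D_def)
  have fin: "finite M"
  proof (rule ccontr)
    assume "infinite M"
    then obtain x :: "nat \<Rightarrow> 'a" where x: "inj x" "range x \<subseteq> M"
      using infinite_countable_subset by blast
    have "lattice_atom (x n)" for n using x by (intro atom) auto
    then have nz: "0 \<le> x n" "x n \<noteq> 0" for n by (auto simp: lattice_atom_def)
    have "disjoint_seq x"
      unfolding disjoint_seq_def using x nz disj by (auto simp: inj_eq image_subset_iff)
    with no_seq nz show False by blast
  qed
  have cone: "x \<in> span M" if x: "0 \<le> x" for x
  proof (rule ccontr)
    assume nx: "x \<notin> span M"
    have "\<exists>y. 0 \<le> y \<and> y \<noteq> 0 \<and> (\<forall>a\<in>M. inf y a = 0)"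
      by (rule disjoint_from_finite_atoms[OF fin _ _ x nx], erule atom, erule (2) disj) blast
    then obtain y where y: "0 \<le> y" "y \<noteq> 0" "\<And>a. a \<in> M \<Longrightarrow> inf y a = 0" by blast
    obtain b where b: "lattice_atom b" "b \<le> y"
      using ex_lattice_atom_below[OF no_seq y(1,2)] by blast
    have b0: "0 \<le> b" "b \<noteq> 0" using b by (auto simp: lattice_atom_def)
    have bd: "inf b a = 0" if "a \<in> M" for a
      by (rule inf_eq_0_mono[OF y(3)[OF that] b0(1) b(2) _ order_refl])
        (use atom[OF that] in \<open>simp add: lattice_atom_def\<close>)
    then have "inf a b = 0" if "a \<in> M" for a using that by (subst inf_commute)
    with b(1) atom disj bd have "insert b M \<in> D" unfolding D_def by blast
    with max have "b \<in> M" by blast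
    with bd[of b] b0 show False by simp
  qed
  have "x \<in> span M" for x :: 'a
  proof -
    have "pprt x - pprt (- x) \<in> span M" by (intro span_diff cone) auto
    then show ?thesis by (simp only: pprt_diff_pprt_uminus)
  qed
  with fin inf show False by (auto simp: finite_dimensional_def)
qed

section \<open>The modulus of a bounded functional\<close>

text \<open>The Riesz-Kantorovich formula for the modulus of \<open>f\<close>. It is meant for the
  positive cone only, since no \<open>y\<close> qualifies for other \<open>x\<close>.\<close>

definition cone_modulus :: "('a::banach_lattice \<Rightarrow> real) \<Rightarrow> 'a \<Rightarrow> real" where
  "cone_modulus f x = Sup {f y |y. \<bar>y\<bar> \<le> x}"

definition functional_modulus :: "('a::banach_lattice \<Rightarrow> real) \<Rightarrow> 'a \<Rightarrow> real" where
  "functional_modulus f x = cone_modulus f (pprt x) - cone_modulus f (pprt (- x))"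

context
  fixes f :: "'a::banach_lattice \<Rightarrow> real"
  assumes f: "bounded_linear f"
begin

interpretation f: bounded_linear f by (rule f)

lemma le_cone_modulus:
  assumes "\<bar>y\<bar> \<le> x"
  shows "f y \<le> cone_modulus f x"
proof -
  obtain K where K: "0 \<le> K" "\<And>x. norm (f x) \<le> norm x * K" using f.nonneg_bounded by blast
  have "bdd_above {f y |y. \<bar>y\<bar> \<le> x}"
  proof (rule bdd_aboveI, clarify)
    fix y assume "\<bar>y\<bar> \<le> x"
    then have "norm y \<le> norm x" by (intro norm_mono_abs order_trans[OF _ abs_ge_self])
    with K show "f y \<le> norm x * K"
      by (smt (verit) mult_right_mono real_norm_def)
  qed
  with assms show ?thesis unfolding cone_modulus_def by (auto intro: cSup_upper)
qed

lemma cone_modulus_le: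
  assumes "0 \<le> x" "\<And>y. \<bar>y\<bar> \<le> x \<Longrightarrow> f y \<le> c"
  shows "cone_modulus f x \<le> c"
  unfolding cone_modulus_def using assms by (intro cSup_least) (auto intro!: exI[of _ 0])

lemma cone_modulus_nonneg: "0 \<le> x \<Longrightarrow> 0 \<le> cone_modulus f x"
  using le_cone_modulus[of 0 x] by (simp add: f.zero)

text \<open>Riesz decomposition of the competitors for \<open>a + b\<close> gives
  \<open>\<le>\<close>; the triangle inequality gives \<open>\<ge>\<close>.\<close>

lemma cone_modulus_add:
  assumes "0 \<le> a" "0 \<le> b"
  shows "cone_modulus f (a + b) = cone_modulus f a + cone_modulus f b"
proof (rule antisym)
  show "cone_modulus f (a + b) \<le> cone_modulus f a + cone_modulus f b"
  proof (rule cone_modulus_le)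
    fix y assume "\<bar>y\<bar> \<le> a + b"
    then obtain u v where "y = u + v" "\<bar>u\<bar> \<le> a" "\<bar>v\<bar> \<le> b"
      using riesz_decomposition assms by metis
    then show "f y \<le> cone_modulus f a + cone_modulus f b"
      by (simp add: f.add add_mono le_cone_modulus)
  qed (use assms in simp)
  have "f u + f v \<le> cone_modulus f (a + b)" if "\<bar>u\<bar> \<le> a" "\<bar>v\<bar> \<le> b" for u v
  proof -
    have "\<bar>u + v\<bar> \<le> a + b" using that by (meson abs_triangle_ineq add_mono order_trans)
    from le_cone_modulus[OF this] show ?thesis by (simp add: f.add)
  qed
  \<comment> \<open>The suprema are taken one at a time: first over \<open>u\<close> with
    \<open>v\<close> fixed, then over \<open>v\<close>.\<close>
  then have "cone_modulus f a \<le> cone_modulus f (a + b) - f v" if "\<bar>v\<bar> \<le> b" for v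
    using assms that by (intro cone_modulus_le) (auto simp: algebra_simps)
  then have "cone_modulus f b \<le> cone_modulus f (a + b) - cone_modulus f a"
    using assms by (intro cone_modulus_le) (auto simp: algebra_simps)
  then show "cone_modulus f a + cone_modulus f b \<le> cone_modulus f (a + b)" by simp
qed

text \<open>For positive scalars \<open>\<le>\<close> follows by rescaling the competitors; applied
  to \<open>inverse c\<close> it gives the converse.\<close>

lemma cone_modulus_scaleR:
  assumes "0 \<le> x" "0 \<le> c"
  shows "cone_modulus f (c *\<^sub>R x) = c * cone_modulus f x"
proof (cases "c = 0")
  case True
  have "cone_modulus f 0 = 0" using cone_modulus_add[of 0 0] by simp
  with True show ?thesis by simp
next
  case False
  have le: "cone_modulus f (c *\<^sub>R x) \<le> c * cone_modulus f x" if "0 < c" "0 \<le> x" for c x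
  proof (rule cone_modulus_le)
    fix y assume "\<bar>y\<bar> \<le> c *\<^sub>R x"
    then have "inverse c *\<^sub>R \<bar>y\<bar> \<le> inverse c *\<^sub>R (c *\<^sub>R x)"
      using that by (intro scaleR_left_mono) auto
    with that have "\<bar>inverse c *\<^sub>R y\<bar> \<le> x" by (simp add: abs_scaleR_lattice)
    from le_cone_modulus[OF this] that show "f y \<le> c * cone_modulus f x"
      by (simp add: f.scaleR field_simps)
  qed (use that in \<open>simp add: scaleR_nonneg_nonneg\<close>)
  have "cone_modulus f (inverse c *\<^sub>R (c *\<^sub>R x)) \<le> inverse c * cone_modulus f (c *\<^sub>R x)"
    using assms False by (intro le) (auto intro: scaleR_nonneg_nonneg)
  then have "c * cone_modulus f x \<le> cone_modulus f (c *\<^sub>R x)"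
    using assms False by (simp add: field_simps)
  with le[of c x] assms False show ?thesis by simp
qed

text \<open>The value is independent of how a vector is written as a difference of positive ones,
  which is what linearity rests on. Two such representations are compared by rearranging them into
  an equation of sums in the cone and using additivity there.\<close>

lemma functional_modulus_diff_cone:
  assumes "0 \<le> a" "0 \<le> b"
  shows "functional_modulus f (a - b) = cone_modulus f a - cone_modulus f b"
proof -
  have "a - b = pprt (a - b) - pprt (- (a - b))" by (simp only: pprt_diff_pprt_uminus)
  then have "pprt (a - b) + b = a + pprt (- (a - b))" by (simp add: algebra_simps)
  then have "cone_modulus f (pprt (a - b) + b) = cone_modulus f (a + pprt (- (a - b)))" by simp
  then show ?thesis using assms by (simp add: cone_modulus_add functional_modulus_def)
qed

lemma functional_modulus_nonneg_eq: "0 \<le> x \<Longrightarrow> functional_modulus f x = cone_modulus f x"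
  using functional_modulus_diff_cone[of x 0] cone_modulus_scaleR[of 0 0] by simp

lemma functional_modulus_nonneg: "0 \<le> x \<Longrightarrow> 0 \<le> functional_modulus f x"
  by (simp add: functional_modulus_nonneg_eq cone_modulus_nonneg)

lemma abs_le_functional_modulus: "\<bar>f x\<bar> \<le> functional_modulus f \<bar>x\<bar>"
  using le_cone_modulus[of x "\<bar>x\<bar>"] le_cone_modulus[of "- x" "\<bar>x\<bar>"]
  by (simp add: functional_modulus_nonneg_eq f.neg abs_le_iff)

lemma bounded_linear_functional_modulus: "bounded_linear (functional_modulus f)"
proof -
  note pn = pprt_diff_pprt_uminus[symmetric]
  obtain K where K: "0 \<le> K" "\<And>x. norm (f x) \<le> norm x * K" using f.nonneg_bounded by blast
  show ?thesis
  proof (rule bounded_linear_intro)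
    fix x y :: 'a
    have "functional_modulus f (x + y) =
      functional_modulus f ((pprt x + pprt y) - (pprt (- x) + pprt (- y)))"
      using pn[of x] pn[of y] by (metis add_diff_add)
    then show "functional_modulus f (x + y) = functional_modulus f x + functional_modulus f y"
      by (subst (asm) functional_modulus_diff_cone)
        (auto simp: cone_modulus_add functional_modulus_def)
  next
    fix r and x :: 'a
    have pos: "functional_modulus f (c *\<^sub>R z) = c * functional_modulus f z" if "0 \<le> c" for c z
    proof -
      have "functional_modulus f (c *\<^sub>R z) = functional_modulus f (c *\<^sub>R pprt z - c *\<^sub>R pprt (- z))"
        using pn[of z] by (metis scaleR_right_diff_distrib)
      with that show ?thesis
        by (subst (asm) functional_modulus_diff_cone)
          (auto simp: cone_modulus_scaleR functional_modulus_def algebra_simps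
            intro: scaleR_nonneg_nonneg)
    qed
    have neg: "functional_modulus f (- z) = - functional_modulus f z" for z
      by (simp add: functional_modulus_def)
    show "functional_modulus f (r *\<^sub>R x) = r *\<^sub>R functional_modulus f x"
      using pos[of r x] pos[of "- r" "x"] neg[of "r *\<^sub>R x"] by (cases "0 \<le> r") auto
  next
    fix x :: 'a
    have cone: "cone_modulus f y \<le> norm x * K" if "0 \<le> y" "y \<le> \<bar>x\<bar>" for y
    proof (rule cone_modulus_le)
      fix z assume "\<bar>z\<bar> \<le> y"
      then have "norm z \<le> norm x" using that by (intro norm_mono_abs) (auto intro: order_trans)
      with K show "f z \<le> norm x * K" by (smt (verit) mult_right_mono real_norm_def)
    qed (use that in simp)
    have le: "pprt z \<le> \<bar>z\<bar>" for z :: 'a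
      unfolding pprt_def by (simp add: abs_ge_self)
    \<comment> \<open>Both cone values lie between 0 and \<open>norm x * K\<close>, hence so does
      the absolute value of their difference.\<close>
    show "norm (functional_modulus f x) \<le> norm x * K"
      using cone[of "pprt x"] cone[of "pprt (- x)"] le[of x] le[of "- x"]
        cone_modulus_nonneg[of "pprt x"] cone_modulus_nonneg[of "pprt (- x)"]
      by (simp add: functional_modulus_def)
  qed
qed

end

section \<open>Disjointly weakly compact operators\<close>

text \<open>Choosing signs, \<open>\<Sum>\<bar>f x\<^sub>n\<bar>\<close> is the value of \<open>f\<close> at an element of the interval
  \<open>[-e, e]\<close>, so the series converges.\<close>

lemma order_bounded_disjoint_weakly_null:
  fixes x :: "nat \<Rightarrow> 'a::banach_lattice"
  assumes disj: "disjoint_seq x" and bound: "\<And>n. \<bar>x n\<bar> \<le> e"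
  shows "weakly_tendsto x 0"
  unfolding weakly_tendsto_def
proof (intro allI impI)
  fix f :: "'a \<Rightarrow> real" assume "bounded_linear f"
  then interpret f: bounded_linear f .
  obtain K where K: "0 \<le> K" "\<And>x. norm (f x) \<le> norm x * K" using f.nonneg_bounded by blast
  have e: "0 \<le> e" using bound[of 0] by (rule order_trans[OF abs_ge_zero])
  have partial: "(\<Sum>i<n. \<bar>f (x i)\<bar>) \<le> norm e * K" for n
  proof -
    let ?y = "\<Sum>i<n. sgn (f (x i)) *\<^sub>R x i"
    have "\<bar>?y\<bar> \<le> (\<Sum>i<n. \<bar>sgn (f (x i)) *\<^sub>R x i\<bar>)" by (rule abs_sum_le_lattice)
    also have "\<dots> \<le> (\<Sum>i<n. \<bar>x i\<bar>)"
      by (intro sum_mono) (auto simp: abs_scaleR_lattice abs_sgn_eq)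
    also have "\<dots> \<le> e"
      using disj bound e by (intro sum_disjoint_le) (auto simp: disjoint_seq_def)
    finally have "norm ?y \<le> norm e" using e by (intro norm_mono_abs) simp
    have "(\<Sum>i<n. \<bar>f (x i)\<bar>) = f ?y"
      by (simp add: f.sum f.scaleR abs_sgn mult.commute)
    also have "\<dots> \<le> norm ?y * K" using K(2)[of ?y] by simp
    also have "\<dots> \<le> norm e * K" using \<open>norm ?y \<le> norm e\<close> K by (intro mult_right_mono)
    finally show ?thesis .
  qed
  have "summable (\<lambda>i. \<bar>f (x i)\<bar>)"
    by (rule summableI_nonneg_bounded[OF _ partial]) simp
  then have "(\<lambda>n. f (x n)) \<longlonglongrightarrow> 0"
    using summable_LIMSEQ_zero tendsto_rabs_zero_iff by blast
  then show "(\<lambda>n. f (x n)) \<longlonglongrightarrow> f 0" by (simp add: f.zero)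
qed

text \<open>If \<open>K\<close> bounds \<open>g\<close>, every element of the solid hull of the
  image of the unit ball has modulus at most \<open>K *\<^sub>R e\<close>. Disjoint sequences in it
  are thus order bounded, hence weakly null.\<close>

lemma disjointly_weakly_compact_rank_one:
  fixes g :: "'x::banach \<Rightarrow> real" and e :: "'a::banach_lattice"
  assumes g: "bounded_linear g" and e: "0 \<le> e"
  shows "disjointly_weakly_compact_operator (\<lambda>x. g x *\<^sub>R e)"
proof -
  have T: "bounded_linear (\<lambda>x. g x *\<^sub>R e)"
    using bounded_linear_compose[OF bounded_linear_scaleR_left g] .
  obtain K where K: "0 \<le> K" "\<And>x. norm (g x) \<le> norm x * K"
    using bounded_linear.nonneg_bounded[OF g] by blast
  have "weakly_tendsto x 0"
    if x: "disjoint_seq x" "range x \<subseteq> solid_hull ((\<lambda>x. g x *\<^sub>R e) ` cball 0 1)" for x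
  proof (rule order_bounded_disjoint_weakly_null[OF x(1)])
    fix n
    obtain b where b: "norm b \<le> 1" "\<bar>x n\<bar> \<le> \<bar>g b *\<^sub>R e\<bar>"
      using x(2) by (fastforce simp: solid_hull_def)
    have "\<bar>g b\<bar> \<le> K" using K(2)[of b] mult_right_mono[OF b(1) K(1)] by simp
    then have "\<bar>g b\<bar> *\<^sub>R e \<le> K *\<^sub>R e" using e by (intro scaleR_right_mono)
    with b e show "\<bar>x n\<bar> \<le> K *\<^sub>R e" by (simp add: abs_scaleR_lattice)
  qed
  with T show ?thesis
    by (auto simp: disjointly_weakly_compact_operator_def disjointly_weakly_compact_set_def
        intro: bounded_linear_image)
qed

text \<open>For each \<open>f\<close> the hypothesis is applied to a positive rank one operator
  built from the modulus of \<open>f\<close>. The sequence of moduli is again bounded and disjoint,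
  so \<open>functional_modulus f\<close> tends to 0 along it, and it dominates
  \<open>f\<close>.\<close>

lemma bounded_disjoint_weakly_null:
  fixes x :: "nat \<Rightarrow> 'a::banach_lattice"
  assumes M: "\<And>T :: 'a \<Rightarrow> 'a. positive_operator T \<Longrightarrow> disjointly_weakly_compact_operator T
      \<Longrightarrow> M_weakly_compact_operator T"
    and x: "bounded (range x)" "disjoint_seq x"
  shows "weakly_tendsto x 0"
  unfolding weakly_tendsto_def
proof (intro allI impI)
  fix f :: "'a \<Rightarrow> real" assume f: "bounded_linear f"
  let ?g = "functional_modulus f"
  have g: "bounded_linear ?g" by (rule bounded_linear_functional_modulus[OF f])
  have "(\<lambda>n. f (x n)) \<longlonglongrightarrow> 0"
  proof (cases "\<forall>n. x n = 0")
    case True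
    then show ?thesis using linear_0[OF bounded_linear.linear[OF f]] by simp
  next
    case False
    then obtain k where k: "x k \<noteq> 0" by blast
    \<comment> \<open>The range needs some nonzero positive vector; a nonzero term of the sequence
      supplies one.\<close>
    let ?T = "\<lambda>y. ?g y *\<^sub>R \<bar>x k\<bar>"
    have dwc: "disjointly_weakly_compact_operator ?T"
      by (rule disjointly_weakly_compact_rank_one[OF g]) simp
    moreover have "positive_operator ?T"
      using dwc functional_modulus_nonneg[OF f]
      by (auto simp: positive_operator_def disjointly_weakly_compact_operator_def
          intro: bounded_linear.linear scaleR_nonneg_nonneg)
    ultimately have "M_weakly_compact_operator ?T" by (intro M)
    moreover have "bounded (range (\<lambda>n. \<bar>x n\<bar>))" using x(1) by (auto simp: bounded_iff)
    moreover have "disjoint_seq (\<lambda>n. \<bar>x n\<bar>)" using x(2) by (simp add: disjoint_seq_def)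
    ultimately have "(\<lambda>n. norm (?T \<bar>x n\<bar>)) \<longlonglongrightarrow> 0"
      unfolding M_weakly_compact_operator_def by blast
    then have "(\<lambda>n. \<bar>?g \<bar>x n\<bar>\<bar> * norm (x k) * inverse (norm (x k))) \<longlonglongrightarrow> 0 * inverse (norm (x k))"
      by (intro tendsto_mult_right) simp
    with k have "(\<lambda>n. ?g \<bar>x n\<bar>) \<longlonglongrightarrow> 0" by (simp add: tendsto_rabs_zero_iff mult.assoc)
    then show ?thesis
      by (rule Lim_null_comparison[rotated]) (simp add: abs_le_functional_modulus[OF f])
  qed
  then show "(\<lambda>n. f (x n)) \<longlonglongrightarrow> f 0" using linear_0[OF bounded_linear.linear[OF f]] by simp
qed

section \<open>Finite dimension characterised by positive operators\<close>

theorem theorem3p19: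
  assumes "sigma_dedekind_complete TYPE('e::banach_lattice)"
  shows "finite_dimensional TYPE('e) \<longleftrightarrow>
    (\<forall>T :: 'e \<Rightarrow> 'e. positive_operator T \<and> disjointly_weakly_compact_operator T
       \<longrightarrow> M_weakly_compact_operator T)"
proof (intro iffI allI impI)
  fix T :: "'e \<Rightarrow> 'e"
  assume fd: "finite_dimensional TYPE('e)"
    and "positive_operator T \<and> disjointly_weakly_compact_operator T"
  then have T: "bounded_linear T" by (simp add: disjointly_weakly_compact_operator_def)
  have "(\<lambda>n. norm (T (x n))) \<longlonglongrightarrow> 0" if "disjoint_seq x" for x
  proof (rule tendsto_eventually)
    have "eventually (\<lambda>n. x n = 0) cofinite"
      using finite_nonzero_disjoint_seq[OF fd that] by (simp add: eventually_cofinite)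
    then show "\<forall>\<^sub>F n in sequentially. norm (T (x n)) = 0"
      unfolding cofinite_eq_sequentially
      by eventually_elim (simp add: linear_0[OF bounded_linear.linear[OF T]])
  qed
  with T show "M_weakly_compact_operator T" by (simp add: M_weakly_compact_operator_def)
next
  assume M: "\<forall>T :: 'e \<Rightarrow> 'e. positive_operator T \<and> disjointly_weakly_compact_operator T
    \<longrightarrow> M_weakly_compact_operator T"
  show "finite_dimensional TYPE('e)"
  proof (rule ccontr)
    assume "\<not> finite_dimensional TYPE('e)"
    then obtain x :: "nat \<Rightarrow> 'e" where x: "disjoint_seq x" "\<And>n. x n \<noteq> 0"
      using ex_disjoint_seq_nonzero by blast
    \<comment> \<open>The unit ball is its own image under the identity, so this is disjoint weak
      compactness of the identity operator.\<close>
    have "disjointly_weakly_compact_set (cball 0 1 :: 'e set)"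
      unfolding disjointly_weakly_compact_set_def
    proof (intro conjI allI impI bounded_cball)
      fix y :: "nat \<Rightarrow> 'e"
      assume y: "disjoint_seq y \<and> range y \<subseteq> solid_hull (cball 0 1)"
      have "norm (y n) \<le> 1" for n
      proof -
        obtain b where "norm b \<le> 1" "\<bar>y n\<bar> \<le> \<bar>b\<bar>" using y by (fastforce simp: solid_hull_def)
        then show ?thesis using norm_mono_abs order_trans by blast
      qed
      then have "bounded (range y)" by (auto simp: bounded_iff)
      with y M show "weakly_tendsto y 0" by (intro bounded_disjoint_weakly_null) auto
    qed
    then have "disjointly_weakly_compact_operator (\<lambda>x :: 'e. x)"
      by (simp add: disjointly_weakly_compact_operator_def bounded_linear_ident)
    moreover have "positive_operator (\<lambda>x :: 'e. x)"
      by (simp add: positive_operator_def linear_iff)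
    ultimately have "M_weakly_compact_operator (\<lambda>x :: 'e. x)" using M by blast
    \<comment> \<open>Normalisation preserves disjointness and fixes all norms at 1, which
      contradicts M-weak compactness of the identity.\<close>
    moreover define u where "u = (\<lambda>n. inverse (norm (x n)) *\<^sub>R x n)"
    have norm_u: "norm (u n) = 1" for n using x(2)[of n] by (simp add: u_def)
    then have "bounded (range u)" by (auto simp: bounded_iff)
    moreover have "disjoint_seq u"
      using x(1) by (simp add: disjoint_seq_def u_def abs_scaleR_lattice inf_scaleR_eq_0)
    ultimately have "(\<lambda>n. norm (u n)) \<longlonglongrightarrow> 0" unfolding M_weakly_compact_operator_def by blast
    then show False by (simp add: norm_u LIMSEQ_const_iff)
  qed
qed

end
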